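(* For each vincular pattern $\tau\in\{2\text{-}13,\,2\text{-}31,\,13\text{-}2,\,31\text{-}2\}$, let $\tau(\sigma)$ denote the number of occurrences of $\tau$ in $\sigma$. Then, as formal power series in $t$, $$\sum_{n\ge0}\sum_{\sigma\in\mathfrak{S}_n}q^{\tau(\sigma)}t^n=\cfrac{1}{1-\cfrac{[1]_q t}{1-\cfrac{[1]_q t}{1-\cfrac{[2]_q t}{1-\cfrac{[2]_q t}{1-\cdots}}}}},$$ i.e. the Stieltjes-type continued fraction with coefficients $\alpha_{2k-1}=\alpha_{2k}=[k]_q$ for $k\ge1$. Hence each of these statistics exhibits the cyclic sieving phenomenon with respect to involutions that have $1$ fixed point when $n=0$ and $2^{n-1}$ fixed points when $n\ge1$.
   Context: $\mathfrak{S}_n$ is the set of permutations $\sigma=\sigma_1\cdots\sigma_n$ of $[n]$, and $[k]_q=1+q+\dots+q^{k-1}$. An occurrence of the vincular pattern $2\text{-}13$ in $\sigma$ is a pair of positions $i<j\le n-1$ with $\sigma_j<\sigma_i<\sigma_{j+1}$; of $2\text{-}31$: $i<j\le n-1$ with $\sigma_{j+1}<\sigma_i<\sigma_j$; of $13\text{-}2$: $i<i+1<k$ with $\sigma_i<\sigma_k<\sigma_{i+1}$; of $31\text{-}2$: $i<i+1<k$ with $\sigma_{i+1}<\sigma_k<\sigma_i$ (the letters joined without a dash must be adjacent positions). Cyclic sieving for involutions: for an involution $\phi$ on a finite set $X$ and polynomial $f$, $(X,\{\mathrm{id},\phi\},f)$ exhibits the CSP iff $f(1)=|X|$ and $f(-1)$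 equals the number of fixed points of $\phi$; a statistic exhibits the CSP with respect to involutions having $a_n$ fixed points if for every $n$ and every involution $\phi$ of $\mathfrak{S}_n$ with exactly $a_n$ fixed points, $(\mathfrak{S}_n,\{\mathrm{id},\phi\},\sum_{\sigma}q^{\mathrm{stat}(\sigma)})$ exhibits the CSP. *)

theory Defs
  imports
    "HOL-Combinatorics.Permutations"
    "HOL-Computational_Algebra.Formal_Power_Series"
    "HOL-Computational_Algebra.Polynomial"
begin

definition perms :: "nat \<Rightarrow> (nat \<Rightarrow> nat) set" where
  "perms n = {\<sigma>. \<sigma> permutes {1..n}}"

definition occ_2_13 :: "nat \<Rightarrow> (nat \<Rightarrow> nat) \<Rightarrow> nat" where
  "occ_2_13 n \<sigma> = card {(i, j). 1 \<le> i \<and> i < j \<and> j + 1 \<le> n \<and> \<sigma> j < \<sigma> i \<and> \<sigma> i < \<sigma> (j + 1)}"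

definition occ_2_31 :: "nat \<Rightarrow> (nat \<Rightarrow> nat) \<Rightarrow> nat" where
  "occ_2_31 n \<sigma> = card {(i, j). 1 \<le> i \<and> i < j \<and> j + 1 \<le> n \<and> \<sigma> (j + 1) < \<sigma> i \<and> \<sigma> i < \<sigma> j}"

definition occ_13_2 :: "nat \<Rightarrow> (nat \<Rightarrow> nat) \<Rightarrow> nat" where
  "occ_13_2 n \<sigma> = card {(i, k). 1 \<le> i \<and> i + 1 < k \<and> k \<le> n \<and> \<sigma> i < \<sigma> k \<and> \<sigma> k < \<sigma> (i + 1)}"

definition occ_31_2 :: "nat \<Rightarrow> (nat \<Rightarrow> nat) \<Rightarrow> nat" where
  "occ_31_2 n \<sigma> = card {(i, k). 1 \<le> i \<and> i + 1 < k \<and> k \<le> n \<and> \<sigma> (i + 1) < \<sigma> k \<and> \<sigma> k < \<sigma> i}"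

text \<open>Polynomials in \<open>q\<close> are elements of \<^typ>\<open>int poly\<close>; power series in \<open>t\<close> with such
  coefficients are elements of \<^typ>\<open>int poly fps\<close>, with \<open>t\<close> rendered as \<open>fps_X\<close>.\<close>

definition q_int :: "nat \<Rightarrow> int poly" where
  "q_int k = (\<Sum>i<k. monom 1 i)"

definition stat_poly :: "(nat \<Rightarrow> (nat \<Rightarrow> nat) \<Rightarrow> nat) \<Rightarrow> nat \<Rightarrow> int poly" where
  "stat_poly stat n = (\<Sum>\<sigma>\<in>perms n. monom 1 (stat n \<sigma>))"

text \<open>\<open>sfrac_convergent \<alpha> k m\<close> is the finite continued fraction
  \<open>1 / (1 - \<alpha> k t / (1 - \<alpha> (k + 1) t / (\<dots> / (1 - \<alpha> (k + m - 1) t))))\<close>.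
  The type \<^typ>\<open>int poly\<close> is not of class \<open>inverse\<close>, so the reciprocal of a series with constant
  coefficient 1 is written \<open>fps_right_inverse _ 1\<close>.\<close>

fun sfrac_convergent :: "(nat \<Rightarrow> 'a::comm_ring_1) \<Rightarrow> nat \<Rightarrow> nat \<Rightarrow> 'a fps" where
  "sfrac_convergent \<alpha> k 0 = 1"
| "sfrac_convergent \<alpha> k (Suc m) =
     fps_right_inverse (1 - fps_const (\<alpha> k) * fps_X * sfrac_convergent \<alpha> (Suc k) m) 1"

lemma sfrac_convergent_Suc_mult:
  "(1 - fps_const (\<alpha> k) * fps_X * sfrac_convergent \<alpha> (Suc k) m) * sfrac_convergent \<alpha> k (Suc m) = 1"
  unfolding sfrac_convergent.simps by (rule fps_right_inverse) simp

text \<open>The infinite fraction with coefficients \<open>\<alpha> 1, \<alpha> 2, \<dots>\<close> is the limit of its convergents in the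
  usual (\<open>t\<close>-adic) topology on power series.\<close>

definition has_sfrac_expansion :: "'a::comm_ring_1 fps \<Rightarrow> (nat \<Rightarrow> 'a) \<Rightarrow> bool" where
  "has_sfrac_expansion F \<alpha> \<longleftrightarrow> (\<lambda>m. sfrac_convergent \<alpha> 1 m) \<longlonglongrightarrow> F"

definition sfrac_coeff :: "nat \<Rightarrow> int poly" where
  "sfrac_coeff j = q_int ((j + 1) div 2)"

lemma sfrac_coeff_odd: "k \<ge> 1 \<Longrightarrow> sfrac_coeff (2 * k - 1) = q_int k"
  and sfrac_coeff_even: "sfrac_coeff (2 * k) = q_int k"
  by (simp_all add: sfrac_coeff_def)

definition involution_on :: "'a set \<Rightarrow> ('a \<Rightarrow> 'a) \<Rightarrow> bool" where
  "involution_on X \<phi> \<longleftrightarrow> (\<forall>x\<in>X. \<phi> x \<in> X \<and> \<phi> (\<phi> x) = x)"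

definition fixed_points :: "'a set \<Rightarrow> ('a \<Rightarrow> 'a) \<Rightarrow> 'a set" where
  "fixed_points X \<phi> = {x \<in> X. \<phi> x = x}"

definition exhibits_CSP :: "'a set \<Rightarrow> ('a \<Rightarrow> 'a) \<Rightarrow> int poly \<Rightarrow> bool" where
  "exhibits_CSP X \<phi> f \<longleftrightarrow> finite X \<and> involution_on X \<phi> \<and>
     poly f 1 = int (card X) \<and> poly f (-1) = int (card (fixed_points X \<phi>))"

definition stat_exhibits_CSP :: "(nat \<Rightarrow> (nat \<Rightarrow> nat) \<Rightarrow> nat) \<Rightarrow> (nat \<Rightarrow> nat) \<Rightarrow> bool" where
  "stat_exhibits_CSP stat a \<longleftrightarrow>
     (\<forall>n \<phi>. involution_on (perms n) \<phi> \<and> card (fixed_points (perms n) \<phi>) = a n \<longrightarrow>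
        exhibits_CSP (perms n) \<phi> (stat_poly stat n))"

end

theory Submission
  imports Defs "HOL-Combinatorics.Multiset_Permutations"
begin

text \<open>Reversal and complement reduce all four patterns to 31-2. Build a permutation by inserting its
  values in increasing order, keeping track of the maximal runs of positions not yet filled (holes).
  The next value \<open>v\<close> goes into a hole, leaving a hole on its left, on its right, on both sides or on
  neither, and plays the role of the 2 in one occurrence of 31-2 for each hole further left. Hence the
  enumeration by the number of holes satisfies the same tridiagonal recurrence, up to a factor
  \<open>[h]\<^sub>q!\<close>, as the pairs of consecutive steps of Dyck path prefixes with down-step weights
  \<open>[1]\<^sub>q, [1]\<^sub>q, [2]\<^sub>q, [2]\<^sub>q, \<dots>\<close>. The generating functions of Dyck path prefixes ending at a
  given height satisfy Euler's three-term recurrence, which yields the continued fraction. At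
  \<open>q = -1\<close> it terminates, since \<open>[2]\<^sub>q = 0\<close>.\<close>

section \<open>Stieltjes fractions\<close>

unbundle fps_syntax

text \<open>Dividing the recurrence by \<open>g (Suc k)\<close> and inverting expresses the ratio
  \<open>g (Suc k) / g k\<close> as one level of the fraction applied to the next ratio. After
  \<open>m\<close> levels this is the convergent, and each level multiplies the error by one more
  factor t. The cleared form avoids dividing by \<open>g k\<close>, which need not be
  invertible.\<close>

lemma sfrac_convergent_Euler_Gauss:
  fixes \<alpha> :: "nat \<Rightarrow> 'a::comm_ring_1"
  assumes rec: "\<And>k. g (Suc k) = g k + fps_const (\<alpha> (Suc k)) * fps_X * g (Suc (Suc k))"
  shows "fps_X ^ Suc m dvd g (Suc k) - sfrac_convergent \<alpha> (Suc k) m * g k"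
proof (induction m arbitrary: k)
  case 0
  have "g (Suc k) - g k = fps_X ^ Suc 0 * (fps_const (\<alpha> (Suc k)) * g (Suc (Suc k)))"
    using rec[of k] by (simp add: algebra_simps)
  then show ?case
    by simp
next
  case (Suc m)
  define a where "a = fps_const (\<alpha> (Suc k))"
  define B where "B = sfrac_convergent \<alpha> (Suc (Suc k)) m"
  define C where "C = sfrac_convergent \<alpha> (Suc k) (Suc m)"
  have C: "(1 - a * fps_X * B) * C = 1"
    unfolding a_def B_def C_def by (rule sfrac_convergent_Suc_mult)
  obtain r where r: "g (Suc (Suc k)) - B * g (Suc k) = fps_X ^ Suc m * r"
    using Suc.IH[of "Suc k"] by (auto simp: B_def elim: dvdE)
  have gk: "g k = g (Suc k) - a * fps_X * g (Suc (Suc k))"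
    using rec[of k] by (simp add: a_def)
  \<comment> \<open>Inserting 1 = (1 - a t B) C turns the error at this level into C a t times the
    error one level deeper.\<close>
  have "g (Suc k) - C * g k = ((1 - a * fps_X * B) * C) * g (Suc k) - C * g k"
    by (simp add: C)
  also have "\<dots> = C * a * fps_X * (g (Suc (Suc k)) - B * g (Suc k))"
    unfolding gk by (simp add: algebra_simps)
  also have "\<dots> = fps_X ^ Suc (Suc m) * (C * a * r)"
    unfolding r by (simp add: algebra_simps)
  finally show ?case
    unfolding C_def by (simp only: dvd_triv_left)
qed

lemma has_sfrac_expansion_Euler_Gauss:
  fixes \<alpha> :: "nat \<Rightarrow> 'a::comm_ring_1"
  assumes rec: "\<And>k. g (Suc k) = g k + fps_const (\<alpha> (Suc k)) * fps_X * g (Suc (Suc k))"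
    and g0: "g 0 = 1"
  shows "has_sfrac_expansion (g (Suc 0)) \<alpha>"
  unfolding has_sfrac_expansion_def
proof (rule tendsto_fpsI)
  fix n
  have "sfrac_convergent \<alpha> 1 m $ n = g (Suc 0) $ n" if "n \<le> m" for m
  proof -
    obtain r where "g (Suc 0) - sfrac_convergent \<alpha> (Suc 0) m * g 0 = fps_X ^ Suc m * r"
      using sfrac_convergent_Euler_Gauss[of g \<alpha> m 0, OF rec] by (auto elim: dvdE)
    then have "(g (Suc 0) - sfrac_convergent \<alpha> (Suc 0) m) $ n = (fps_X ^ Suc m * r) $ n"
      by (simp only: g0 mult_1_right)
    also have "\<dots> = 0"
      using that by (simp only: fps_X_power_mult_nth) simp
    finally show ?thesis
      by simp
  qed
  then show "eventually (\<lambda>m. sfrac_convergent \<alpha> 1 m $ n = g (Suc 0) $ n) sequentially"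
    by (auto simp: eventually_sequentially)
qed

text \<open>\<open>dyck_prefix \<alpha> l k\<close> enumerates the nonnegative lattice paths with \<open>l\<close> steps from height 0 to
  height \<open>k\<close>; up steps have weight 1 and down steps from height \<open>j\<close> have weight \<open>\<alpha> j\<close>.\<close>

fun dyck_prefix :: "(nat \<Rightarrow> 'a::comm_ring_1) \<Rightarrow> nat \<Rightarrow> nat \<Rightarrow> 'a" where
  "dyck_prefix \<alpha> 0 k = (if k = 0 then 1 else 0)"
| "dyck_prefix \<alpha> (Suc l) 0 = \<alpha> 1 * dyck_prefix \<alpha> l 1"
| "dyck_prefix \<alpha> (Suc l) (Suc k) =
     dyck_prefix \<alpha> l k + \<alpha> (Suc (Suc k)) * dyck_prefix \<alpha> l (Suc (Suc k))"

lemma dyck_prefix_eq_0: "l < k \<Longrightarrow> dyck_prefix \<alpha> l k = 0"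
  by (induction \<alpha> l k rule: dyck_prefix.induct) auto

lemma has_sfrac_expansion_dyck_prefix:
  "has_sfrac_expansion (Abs_fps (\<lambda>n. dyck_prefix \<alpha> (2 * n) 0)) \<alpha>"
proof -
  \<comment> \<open>\<open>g\<close> is shifted by one so that \<open>g 0 = 1\<close>:
    \<open>g (Suc k)\<close> enumerates prefixes ending at height \<open>k\<close>. A path of length
    \<open>2 * n + k\<close> ending there has \<open>n\<close> down steps, so t marks down steps,
    and the recurrence comes from removing the last step.\<close>
  define g where "g = case_nat 1 (\<lambda>k. Abs_fps (\<lambda>n. dyck_prefix \<alpha> (2 * n + k) k))"
  have "g (Suc k) = g k + fps_const (\<alpha> (Suc k)) * fps_X * g (Suc (Suc k))" for k
  proof (rule fps_ext)
    fix n
    show "g (Suc k) $ n = (g k + fps_const (\<alpha> (Suc k)) * fps_X * g (Suc (Suc k))) $ n"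
      by (cases n; cases k)
        (simp_all add: g_def mult.assoc dyck_prefix_eq_0)
  qed
  then have "has_sfrac_expansion (g (Suc 0)) \<alpha>"
    by (rule has_sfrac_expansion_Euler_Gauss) (simp add: g_def)
  then show ?thesis
    by (simp add: g_def)
qed

section \<open>Counting 31-2 in words\<close>

fun occ_31_2_list :: "nat list \<Rightarrow> nat" where
  "occ_31_2_list (x # y # zs) =
     length (filter (\<lambda>z. y < z \<and> z < x) zs) + occ_31_2_list (y # zs)"
| "occ_31_2_list _ = 0"

lemma occ_31_2_list_eq_card:
  "occ_31_2_list xs =
     card {(i, k). i + 1 < k \<and> k < length xs \<and> xs ! (i + 1) < xs ! k \<and> xs ! k < xs ! i}"
proof (induction xs rule: occ_31_2_list.induct)
  case (1 x y zs)
  define S where "S = (\<lambda>xs :: nat list.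
    {(i, k). i + 1 < k \<and> k < length xs \<and> xs ! (i + 1) < xs ! k \<and> xs ! k < xs ! i})"
  define T where "T = {j. j < length zs \<and> y < zs ! j \<and> zs ! j < x}"
  have fin: "finite (S (y # zs))"
    by (rule finite_subset[of _ "{..<Suc (length zs)} \<times> {..<Suc (length zs)}"]) (auto simp: S_def)
  have "S (x # y # zs) = (\<lambda>j. (0, j + 2)) ` T \<union> map_prod Suc Suc ` S (y # zs)"
  proof (intro equalityI subsetI)
    fix p
    assume "p \<in> S (x # y # zs)"
    then obtain i k where p: "p = (i, k)" and
      ik: "i + 1 < k" "k < length (x # y # zs)" "(x # y # zs) ! (i + 1) < (x # y # zs) ! k"
        "(x # y # zs) ! k < (x # y # zs) ! i"
      by (auto simp: S_def)
    show "p \<in> (\<lambda>j. (0, j + 2)) ` T \<union> map_prod Suc Suc ` S (y # zs)"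
    proof (cases i)
      case 0
      then have "k - 2 \<in> T" "p = (0, (k - 2) + 2)"
        using ik p by (auto simp: T_def nth_Cons split: nat.splits)
      then show ?thesis
        by blast
    next
      case (Suc i')
      then have "(i', k - 1) \<in> S (y # zs)" "p = map_prod Suc Suc (i', k - 1)"
        using ik p by (auto simp: S_def nth_Cons split: nat.splits)
      then show ?thesis
        by blast
    qed
  qed (auto simp: S_def T_def)
  moreover have "card ((\<lambda>j. (0 :: nat, j + 2)) ` T) = card T"
    by (rule card_image) (auto intro: inj_onI)
  moreover have "card (map_prod Suc Suc ` S (y # zs)) = card (S (y # zs))"
    by (rule card_image) (auto intro: inj_onI)
  moreover have "card ((\<lambda>j. (0, j + 2)) ` T \<union> map_prod Suc Suc ` S (y # zs)) =
      card ((\<lambda>j. (0 :: nat, j + 2)) ` T) + card (map_prod Suc Suc ` S (y # zs))"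
    by (rule card_Un_disjoint) (use fin in \<open>auto simp: T_def\<close>)
  moreover have "length (filter (\<lambda>z. y < z \<and> z < x) zs) = card T"
    by (simp add: length_filter_conv_card T_def)
  ultimately show ?case
    using 1 by (simp add: S_def)
qed (auto simp: card_eq_0_iff)

text \<open>A last letter can only be the 2 of an occurrence, and this one exceeds every possible 3.
  This allows a sentinel to be appended to a permutation.\<close>

lemma occ_31_2_list_snoc_max:
  assumes "\<And>x. x \<in> set xs \<Longrightarrow> x < b"
  shows "occ_31_2_list (xs @ [b]) = occ_31_2_list xs"
  using assms
proof (induction xs rule: occ_31_2_list.induct)
  case (1 x y zs)
  then show ?case
    by (auto simp: not_less less_imp_le)
qed auto

text \<open>The first letter can only be the 3 of an occurrence, so only its comparisons with later
  letters matter.\<close>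

lemma occ_31_2_list_Cons_cong:
  assumes "zs \<noteq> []" "\<And>z. z \<in> set zs \<Longrightarrow> z < x \<longleftrightarrow> z < y"
  shows "occ_31_2_list (x # zs) = occ_31_2_list (y # zs)"
proof (cases zs)
  case (Cons a as)
  have "filter (\<lambda>z. a < z \<and> z < x) as = filter (\<lambda>z. a < z \<and> z < y) as"
    using assms Cons by (intro filter_cong) auto
  then show ?thesis
    using Cons by simp
qed (use assms in simp)

lemma occ_31_2_list_Cons_le:
  assumes "zs \<noteq> []" "x \<le> hd zs"
  shows "occ_31_2_list (x # zs) = occ_31_2_list zs"
proof (cases zs)
  case (Cons a as)
  have "filter (\<lambda>z. a < z \<and> z < x) as = []"
    using assms Cons by (auto simp: filter_empty_conv)
  then show ?thesis
    using Cons by simp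
qed (use assms in simp)

section \<open>Words with holes\<close>

text \<open>A word in \<open>hole_words N m c\<close> is the trace of a longer permutation (followed by one larger
  letter) on the values \<open>1, \<dots>, m\<close>: every maximal run of larger letters is collapsed to a single
  hole, and all \<open>c\<close> holes are represented by the letter \<open>N\<close>, which is intended to exceed \<open>m\<close>.\<close>

definition hole_words :: "nat \<Rightarrow> nat \<Rightarrow> nat \<Rightarrow> nat list set" where
  "hole_words N m c = {w. mset w = mset_set {1..m} + replicate_mset c N \<and>
     successively (\<lambda>a b. a \<noteq> N \<or> b \<noteq> N) w \<and> w \<noteq> [] \<and> last w = N}"

definition hole_poly :: "nat \<Rightarrow> nat \<Rightarrow> nat \<Rightarrow> int poly" where
  "hole_poly N m c = (\<Sum>w\<in>hole_words N m c. monom 1 (occ_31_2_list w))"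

section \<open>Words with a marked occurrence of a letter\<close>

definition splits :: "'a \<Rightarrow> 'a list \<Rightarrow> ('a list \<times> 'a list) set" where
  "splits x w = {(u, z). w = u @ x # z}"

lemma finite_splits: "finite (splits x w)"
proof (rule finite_subset)
  show "splits x w \<subseteq> (\<lambda>i. (take i w, drop (Suc i) w)) ` {..<length w}"
  proof safe
    fix u z
    assume "(u, z) \<in> splits x w"
    then have "(u, z) = (take (length u) w, drop (Suc (length u)) w)" "length u < length w"
      by (auto simp: splits_def)
    then show "(u, z) \<in> (\<lambda>i. (take i w, drop (Suc i) w)) ` {..<length w}"
      by blast
  qed
qed simp

lemma splits_disjoint: "w \<noteq> w' \<Longrightarrow> splits x w \<inter> splits x w' = {}"
  by (auto simp: splits_def)

text \<open>The last hole contains the larger letter at the end, which is never filled, so filling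
  it must leave a hole on the right. Insertions that leave none there therefore mark a nonfinal
  hole.\<close>

definition nonfinal_splits :: "'a \<Rightarrow> 'a list \<Rightarrow> ('a list \<times> 'a list) set" where
  "nonfinal_splits x w = {(u, z) \<in> splits x w. z \<noteq> []}"

lemma nonfinal_splits_subset: "nonfinal_splits x w \<subseteq> splits x w"
  by (auto simp: nonfinal_splits_def)

lemma finite_nonfinal_splits: "finite (nonfinal_splits x w)"
  by (rule finite_subset[OF nonfinal_splits_subset finite_splits])

lemma nonfinal_splits_disjoint: "w \<noteq> w' \<Longrightarrow> nonfinal_splits x w \<inter> nonfinal_splits x w' = {}"
  using splits_disjoint[of w w' x] nonfinal_splits_subset by fast

text \<open>Running through the occurrences of \<open>x\<close> from left to right, the number of
  earlier occurrences takes each value 0, 1, 2, ... once. With \<open>f\<close> a power of q this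
  produces a q-integer.\<close>

lemma sum_splits_count:
  "(\<Sum>(u, z)\<in>splits x w. f (count (mset u) x)) = (\<Sum>i<count (mset w) x. f i)"
proof (induction w arbitrary: f)
  case Nil
  then show ?case
    by (simp add: splits_def)
next
  case (Cons a w)
  let ?c = "\<lambda>(u, z). (a # u, z)"
  have inj: "inj_on ?c (splits x w)"
    by (auto intro: inj_onI)
  show ?case
  proof (cases "a = x")
    case True
    have "splits x (a # w) = insert ([], w) (?c ` splits x w)"
      using True by (auto simp: splits_def Cons_eq_append_conv)
    then have "(\<Sum>(u, z)\<in>splits x (a # w). f (count (mset u) x)) =
        f 0 + (\<Sum>(u, z)\<in>?c ` splits x w. f (count (mset u) x))"
      by (simp only:) (subst sum.insert; auto simp: finite_splits)
    also have "(\<Sum>(u, z)\<in>?c ` splits x w. f (count (mset u) x)) =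
        (\<Sum>(u, z)\<in>splits x w. f (Suc (count (mset u) x)))"
      using True by (subst sum.reindex[OF inj]) (simp add: case_prod_beta')
    also have "\<dots> = (\<Sum>i<count (mset w) x. f (Suc i))"
      by (rule Cons.IH)
    finally show ?thesis
      using True by (simp add: sum.lessThan_Suc_shift del: sum.lessThan_Suc)
  next
    case False
    have "splits x (a # w) = ?c ` splits x w"
      using False by (auto simp: splits_def Cons_eq_append_conv)
    then have "(\<Sum>(u, z)\<in>splits x (a # w). f (count (mset u) x)) =
        (\<Sum>(u, z)\<in>splits x w. f (count (mset u) x))"
      using False by (simp only:) (subst sum.reindex[OF inj], simp add: case_prod_beta')
    then show ?thesis
      using False Cons.IH by simp
  qed
qed

text \<open>The excluded final occurrence is preceded by all the others, so the largest index drops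
  out.\<close>

lemma sum_splits_count_nonfinal:
  fixes f :: "nat \<Rightarrow> 'b::ab_group_add"
  assumes "w \<noteq> []" "last w = x"
  shows "(\<Sum>(u, z)\<in>nonfinal_splits x w. f (count (mset u) x)) =
    (\<Sum>i<count (mset w) x - 1. f i)"
proof -
  obtain v where v: "w = v @ [x]"
    using assms by (metis append_butlast_last_id)
  have "nonfinal_splits x w = splits x w - {(v, [])}"
    using v by (auto simp: nonfinal_splits_def splits_def)
  moreover have "(v, []) \<in> splits x w"
    using v by (simp add: splits_def)
  ultimately have "(\<Sum>(u, z)\<in>nonfinal_splits x w. f (count (mset u) x)) =
      (\<Sum>(u, z)\<in>splits x w. f (count (mset u) x)) - f (count (mset v) x)"
    by (simp add: sum_diff1 finite_splits)
  then show ?thesis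
    using v by (simp add: sum_splits_count)
qed

section \<open>Hole words with a marked hole\<close>

lemma finite_hole_words: "finite (hole_words N m c)"
proof (rule finite_subset)
  show "hole_words N m c \<subseteq> permutations_of_multiset (mset_set {1..m} + replicate_mset c N)"
    by (auto simp: hole_words_def permutations_of_multiset_def)
qed simp

lemma count_hole_words:
  assumes "w \<in> hole_words N m c" "m < N"
  shows "count (mset w) N = c"
proof -
  have "mset w = mset_set {1..m} + replicate_mset c N"
    using assms by (simp add: hole_words_def)
  then show ?thesis
    using assms by simp
qed

definition hole_splits :: "nat \<Rightarrow> nat \<Rightarrow> nat \<Rightarrow> (nat list \<times> nat list) set" where
  "hole_splits N m c = {(u, z). u @ N # z \<in> hole_words N m c}"

definition nonfinal_hole_splits :: "nat \<Rightarrow> nat \<Rightarrow> nat \<Rightarrow> (nat list \<times> nat list) set" where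
  "nonfinal_hole_splits N m c = {(u, z) \<in> hole_splits N m c. z \<noteq> []}"

lemma finite_hole_splits: "finite (hole_splits N m c)" "finite (nonfinal_hole_splits N m c)"
proof -
  have "hole_splits N m c = (\<Union>w\<in>hole_words N m c. splits N w)"
    by (auto simp: hole_splits_def splits_def)
  then show "finite (hole_splits N m c)"
    by (simp add: finite_hole_words finite_splits)
  then show "finite (nonfinal_hole_splits N m c)"
    by (rule rev_finite_subset) (auto simp: nonfinal_hole_splits_def)
qed

text \<open>The exponent anticipates the number of occurrences of 31-2 after the marked hole is
  filled: the old ones, plus one for each hole further left.\<close>

definition split_weight :: "nat \<Rightarrow> nat list \<times> nat list \<Rightarrow> int poly" where
  "split_weight N = (\<lambda>(u, z). monom 1 (occ_31_2_list (u @ N # z) + count (mset u) N))"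

lemma sum_hole_splits:
  assumes "m < N"
  shows "sum (split_weight N) (hole_splits N m c) = q_int c * hole_poly N m c"
proof -
  have "hole_splits N m c = (\<Union>w\<in>hole_words N m c. splits N w)"
    by (auto simp: hole_splits_def splits_def)
  then have "sum (split_weight N) (hole_splits N m c) =
      (\<Sum>w\<in>hole_words N m c. sum (split_weight N) (splits N w))"
    by (simp only:) (rule sum.UNION_disjoint;
      simp add: finite_hole_words finite_splits splits_disjoint)
  also have "\<dots> = (\<Sum>w\<in>hole_words N m c. q_int c * monom 1 (occ_31_2_list w))"
  proof (rule sum.cong[OF refl])
    fix w
    assume w: "w \<in> hole_words N m c"
    have "sum (split_weight N) (splits N w) =
        (\<Sum>(u, z)\<in>splits N w. monom 1 (occ_31_2_list w + count (mset u) N))"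
      by (rule sum.cong) (auto simp: splits_def split_weight_def)
    also have "\<dots> = (\<Sum>i<c. monom 1 (occ_31_2_list w + i))"
      using sum_splits_count[of "\<lambda>i. monom 1 (occ_31_2_list w + i)" N w]
        count_hole_words[OF w assms] by simp
    also have "\<dots> = q_int c * monom 1 (occ_31_2_list w)"
      by (simp add: q_int_def sum_distrib_right mult_monom add.commute)
    finally show "sum (split_weight N) (splits N w) = q_int c * monom 1 (occ_31_2_list w)" .
  qed
  finally show ?thesis
    by (simp add: hole_poly_def sum_distrib_left)
qed

lemma sum_nonfinal_hole_splits:
  assumes "m < N"
  shows "sum (split_weight N) (nonfinal_hole_splits N m (Suc c)) = q_int c * hole_poly N m (Suc c)"
proof -
  have "nonfinal_hole_splits N m (Suc c) = (\<Union>w\<in>hole_words N m (Suc c). nonfinal_splits N w)"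
    by (auto simp: nonfinal_hole_splits_def hole_splits_def nonfinal_splits_def splits_def)
  then have "sum (split_weight N) (nonfinal_hole_splits N m (Suc c)) =
      (\<Sum>w\<in>hole_words N m (Suc c). sum (split_weight N) (nonfinal_splits N w))"
    by (simp only:) (rule sum.UNION_disjoint;
      simp add: finite_hole_words finite_nonfinal_splits nonfinal_splits_disjoint)
  also have "\<dots> = (\<Sum>w\<in>hole_words N m (Suc c). q_int c * monom 1 (occ_31_2_list w))"
  proof (rule sum.cong[OF refl])
    fix w
    assume w: "w \<in> hole_words N m (Suc c)"
    then have ne: "w \<noteq> []" "last w = N"
      by (auto simp: hole_words_def)
    have "sum (split_weight N) (nonfinal_splits N w) =
        (\<Sum>(u, z)\<in>nonfinal_splits N w. monom 1 (occ_31_2_list w + count (mset u) N))"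
      by (rule sum.cong) (auto simp: nonfinal_splits_def splits_def split_weight_def)
    also have "\<dots> = (\<Sum>i<c. monom 1 (occ_31_2_list w + i))"
      using sum_splits_count_nonfinal[OF ne, of "\<lambda>i. monom 1 (occ_31_2_list w + i)"]
        count_hole_words[OF w assms] by simp
    also have "\<dots> = q_int c * monom 1 (occ_31_2_list w)"
      by (simp add: q_int_def sum_distrib_right mult_monom add.commute)
    finally show "sum (split_weight N) (nonfinal_splits N w) = q_int c * monom 1 (occ_31_2_list w)" .
  qed
  finally show ?thesis
    by (simp add: hole_poly_def sum_distrib_left)
qed

text \<open>The suffix \<open>D\<close> starts at the old hole and \<open>C\<close> is what replaces
  it. Each hole in \<open>u\<close> is followed within \<open>u\<close> by some
  \<open>b \<le> m\<close>, and by \<open>filter\<close> this descent gains exactly one 2 when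
  \<open>D\<close> becomes \<open>C\<close>; other descents in \<open>u\<close> gain none. The
  junction with \<open>C\<close> or \<open>D\<close> is an ascent, so it contributes
  nothing.\<close>

lemma occ_31_2_list_append_insert:
  assumes "m < N" "set u \<subseteq> insert N {..m}"
    and "successively (\<lambda>a b. a \<noteq> N \<or> b \<noteq> N) u" "u = [] \<or> last u \<noteq> N"
    and C: "C \<noteq> []" "m < hd C" and D: "D \<noteq> []" "m < hd D"
    and CD: "occ_31_2_list C = occ_31_2_list D"
    and filter: "\<And>a b. b \<le> m \<Longrightarrow> a \<in> insert N {..m} \<Longrightarrow>
      length (filter (\<lambda>z. b < z \<and> z < a) C) =
      length (filter (\<lambda>z. b < z \<and> z < a) D) + (if a = N then 1 else 0)"
  shows "occ_31_2_list (u @ C) = occ_31_2_list (u @ D) + count (mset u) N"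
  using assms(2-4)
proof (induction u)
  case Nil
  then show ?case
    using CD by simp
next
  case (Cons a u)
  show ?case
  proof (cases u)
    case Nil
    then have "a \<noteq> N" "a \<le> m"
      using Cons.prems by auto
    then show ?thesis
      using Nil C D CD by (simp add: occ_31_2_list_Cons_le)
  next
    case (Cons b v)
    have IH: "occ_31_2_list (u @ C) = occ_31_2_list (u @ D) + count (mset u) N"
      using Cons.IH Cons.prems Cons by auto
    have "length (filter (\<lambda>z. b < z \<and> z < a) (v @ C)) =
        length (filter (\<lambda>z. b < z \<and> z < a) (v @ D)) + (if a = N then 1 else 0)"
    \<comment> \<open>A step onto a hole is never a descent, so neither side counts
      anything.\<close>
    proof (cases "b = N")
      case True
      then have "a \<noteq> N" "a \<le> m"
        using Cons.prems Cons by auto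
      then have "\<not> (b < z \<and> z < a)" for z
        using True \<open>m < N\<close> by auto
      then show ?thesis
        using \<open>a \<noteq> N\<close> by simp
    next
      case False
      then show ?thesis
        using filter[of b a] Cons.prems Cons by auto
    qed
    then show ?thesis
      using IH Cons by simp
  qed
qed

lemma set_hole_words:
  assumes "w \<in> hole_words N m c"
  shows "set w \<subseteq> insert N {..m}"
proof -
  have "set_mset (mset w) = set_mset (mset_set {1..m} + replicate_mset c N)"
    using assms by (simp add: hole_words_def)
  then show ?thesis
    by (auto split: if_splits)
qed

lemma hole_splitsD:
  assumes "(u, z) \<in> hole_splits N m c" "m < N"
  shows "set u \<subseteq> insert N {..m}" "set z \<subseteq> insert N {..m}"
    and "successively (\<lambda>a b. a \<noteq> N \<or> b \<noteq> N) u" "u = [] \<or> last u \<noteq> N" "z = [] \<or> hd z \<noteq> N"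
proof -
  have w: "u @ N # z \<in> hole_words N m c"
    using assms by (simp add: hole_splits_def)
  show "set u \<subseteq> insert N {..m}" "set z \<subseteq> insert N {..m}"
    using set_hole_words[OF w] by auto
  show "successively (\<lambda>a b. a \<noteq> N \<or> b \<noteq> N) u" "u = [] \<or> last u \<noteq> N" "z = [] \<or> hd z \<noteq> N"
    using w by (auto simp: hole_words_def successively_append_iff successively_Cons)
qed

text \<open>The four equations leave a hole on the right, on both sides, on the left, and on neither
  side. New occurrences use the new value as the 2, one for each hole in \<open>u\<close>. It
  creates no occurrence as a 1, since no letter of \<open>z\<close> lies strictly between
  \<open>Suc m\<close> and \<open>N\<close>; as a 3 it acts on \<open>z\<close> just as the old hole
  did.\<close>

lemma occ_31_2_list_fill_hole:
  assumes uz: "(u, z) \<in> hole_splits N m c" and N: "Suc m < N"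
  shows "occ_31_2_list (u @ Suc m # N # z) = occ_31_2_list (u @ N # z) + count (mset u) N"
    and "occ_31_2_list (u @ N # Suc m # N # z) = occ_31_2_list (u @ N # z) + count (mset u) N"
    and "z \<noteq> [] \<Longrightarrow>
      occ_31_2_list (u @ N # Suc m # z) = occ_31_2_list (u @ N # z) + count (mset u) N"
    and "z \<noteq> [] \<Longrightarrow>
      occ_31_2_list (u @ Suc m # z) = occ_31_2_list (u @ N # z) + count (mset u) N"
proof -
  have mN: "m < N"
    using N by simp
  note D = hole_splitsD[OF uz mN]
  have z: "\<not> (Suc m < y \<and> y < N)" if "y \<in> set z" for y
    using D(2) that by auto
  note insert = occ_31_2_list_append_insert[OF mN D(1,3,4)]
  show "occ_31_2_list (u @ Suc m # N # z) = occ_31_2_list (u @ N # z) + count (mset u) N"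
    by (rule insert) (use N in \<open>auto simp: occ_31_2_list_Cons_le\<close>)
  have "occ_31_2_list (N # Suc m # N # z) = occ_31_2_list (N # z)"
    using N z by (auto simp: occ_31_2_list_Cons_le filter_empty_conv)
  then show "occ_31_2_list (u @ N # Suc m # N # z) = occ_31_2_list (u @ N # z) + count (mset u) N"
    by (intro insert) (use N in auto)
  assume "z \<noteq> []"
  have *: "occ_31_2_list (Suc m # z) = occ_31_2_list (N # z)"
  proof (rule occ_31_2_list_Cons_cong)
    show "y < Suc m \<longleftrightarrow> y < N" if "y \<in> set z" for y
      using D(2) that N by auto
  qed fact
  then show "occ_31_2_list (u @ Suc m # z) = occ_31_2_list (u @ N # z) + count (mset u) N"
    by (intro insert) (use N in auto)
  have "occ_31_2_list (N # Suc m # z) = occ_31_2_list (N # z)"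
    using z * by (auto simp: filter_empty_conv)
  then show "occ_31_2_list (u @ N # Suc m # z) = occ_31_2_list (u @ N # z) + count (mset u) N"
    by (intro insert) (use N in auto)
qed

section \<open>Recurrence in the number of holes\<close>

lemma mset_set_atLeastAtMost_Suc:
  "mset_set {1..Suc m} = add_mset (Suc m) (mset_set {1..m})"
  by (simp add: atLeastAtMostSuc_conv)

text \<open>Merging \<open>Suc m\<close> with its neighbouring holes undoes the insertion. The four
  sets correspond to a hole on the right only, on both sides, on the left only, and on neither side;
  before the insertion there were \<open>Suc c\<close>, \<open>c\<close>, \<open>Suc c\<close> and
  \<open>Suc (Suc c)\<close> holes respectively.\<close>

lemma max_splits_eq:
  assumes N: "Suc m < N"
  shows "{(u, z). u @ Suc m # z \<in> hole_words N (Suc m) (Suc c)} =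
    (\<lambda>(u, z). (u, N # z)) ` hole_splits N m (Suc c) \<union>
    (\<lambda>(u, z). (u @ [N], N # z)) ` hole_splits N m c \<union>
    (\<lambda>(u, z). (u @ [N], z)) ` nonfinal_hole_splits N m (Suc c) \<union>
    nonfinal_hole_splits N m (Suc (Suc c))" (is "?L = ?R")
proof (intro equalityI subsetI)
  fix p
  assume "p \<in> ?L"
  then obtain u z where p: "p = (u, z)" and w: "u @ Suc m # z \<in> hole_words N (Suc m) (Suc c)"
    by auto
  \<comment> \<open>The word ends in \<open>N\<close>, so \<open>Suc m\<close> is not its last
    letter.\<close>
  have "z \<noteq> []"
    using w N by (auto simp: hole_words_def)
  then obtain b y where z: "z = b # y"
    by (cases z) auto
  show "p \<in> ?R"
  proof (cases "u = [] \<or> last u \<noteq> N")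
    case True
    show ?thesis
    proof (cases "b = N")
      case b: True
      have "(u, y) \<in> hole_splits N m (Suc c)"
        using w z b True N unfolding hole_splits_def hole_words_def mset_set_atLeastAtMost_Suc
        by (auto simp: successively_append_iff successively_Cons)
      then show ?thesis
        using p z b by auto
    next
      case b: False
      have "(u, z) \<in> nonfinal_hole_splits N m (Suc (Suc c))"
        using w z b True N
        unfolding nonfinal_hole_splits_def hole_splits_def hole_words_def mset_set_atLeastAtMost_Suc
        by (auto simp: successively_append_iff successively_Cons)
      then show ?thesis
        using p by auto
    qed
  next
    case False
    then obtain v where u: "u = v @ [N]"
      by (metis append_butlast_last_id)
    show ?thesis
    proof (cases "b = N")
      case b: True
      have "(v, y) \<in> hole_splits N m c"
        using w z b u N unfolding hole_splits_def hole_words_def mset_set_atLeastAtMost_Suc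
        by (auto simp: successively_append_iff successively_Cons)
      then show ?thesis
        using p z b u by auto
    next
      case b: False
      have "(v, z) \<in> nonfinal_hole_splits N m (Suc c)"
        using w z b u N
        unfolding nonfinal_hole_splits_def hole_splits_def hole_words_def mset_set_atLeastAtMost_Suc
        by (auto simp: successively_append_iff successively_Cons)
      then show ?thesis
        using p u by auto
    qed
  qed
next
  fix p
  assume "p \<in> ?R"
  then show "p \<in> ?L"
    using N
    unfolding nonfinal_hole_splits_def hole_splits_def hole_words_def mset_set_atLeastAtMost_Suc
    by (auto simp: successively_append_iff successively_Cons)
qed

text \<open>Each word is cut at its unique letter \<open>Suc m\<close>, and the four kinds of
  insertion are summed. Insertions leaving a hole on the right may use any of the old holes, the
  others any but the last; this fixes the q-integer coefficients.\<close>

lemma hole_poly_Suc: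
  assumes N: "Suc m < N"
  shows "hole_poly N (Suc m) (Suc c) =
    q_int c * hole_poly N m c + (q_int (Suc c) + q_int c) * hole_poly N m (Suc c) +
    q_int (Suc c) * hole_poly N m (Suc (Suc c))"
proof -
  have mN: "m < N"
    using N by simp
  define f where "f = (\<lambda>(u, z). monom (1 :: int) (occ_31_2_list (u @ Suc m # z)))"
  let ?Q = "{(u, z). u @ Suc m # z \<in> hole_words N (Suc m) (Suc c)}"
  let ?f1 = "\<lambda>(u, z). (u, N # z)"
  let ?f2 = "\<lambda>(u, z). (u @ [N], N # z)"
  let ?f3 = "\<lambda>(u, z). (u @ [N], z)"
  let ?P1 = "hole_splits N m (Suc c)"
  let ?P2 = "hole_splits N m c"
  let ?P3 = "nonfinal_hole_splits N m (Suc c)"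
  let ?P4 = "nonfinal_hole_splits N m (Suc (Suc c))"
  have max_once: "Suc m \<notin> set u \<and> Suc m \<notin> set z"
    if "u @ Suc m # z \<in> hole_words N (Suc m) (Suc c)" for u z
  proof -
    have "mset u + mset z = mset_set {1..m} + replicate_mset (Suc c) N"
      using that unfolding hole_words_def mset_set_atLeastAtMost_Suc by auto
    then have "set_mset (mset u + mset z) = set_mset (mset_set {1..m} + replicate_mset (Suc c) N)"
      by simp
    then have "set u \<union> set z = {1..m} \<union> {N}"
      by simp
    then show ?thesis
      using N by auto
  qed
  have "bij_betw (\<lambda>(u, z). u @ Suc m # z) ?Q (hole_words N (Suc m) (Suc c))"
  proof (rule bij_betw_imageI)
    show "inj_on (\<lambda>(u, z). u @ Suc m # z) ?Q"
    proof (rule inj_onI)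
      fix p p'
      assume "p \<in> ?Q" "p' \<in> ?Q"
        "(\<lambda>(u, z). u @ Suc m # z) p = (\<lambda>(u, z). u @ Suc m # z) p'"
      then show "p = p'"
        using max_once by (auto simp: append_Cons_eq_iff)
    qed
    have "w \<in> (\<lambda>(u, z). u @ Suc m # z) ` ?Q" if w: "w \<in> hole_words N (Suc m) (Suc c)" for w
    proof -
      have "Suc m \<in># mset w"
        using w unfolding hole_words_def mset_set_atLeastAtMost_Suc by auto
      then obtain u z where "w = u @ Suc m # z"
        by (metis in_multiset_in_set split_list)
      then show ?thesis
        using w by force
    qed
    then show "(\<lambda>(u, z). u @ Suc m # z) ` ?Q = hole_words N (Suc m) (Suc c)"
      by auto
  qed
  then have "hole_poly N (Suc m) (Suc c) =
      (\<Sum>p\<in>?Q. monom 1 (occ_31_2_list ((\<lambda>(u, z). u @ Suc m # z) p)))"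
    unfolding hole_poly_def by (rule sum.reindex_bij_betw[symmetric])
  also have "\<dots> = sum f ?Q"
    by (rule sum.cong) (auto simp: f_def)
  also have "\<dots> = sum f (?f1 ` ?P1) + sum f (?f2 ` ?P2) + sum f (?f3 ` ?P3) + sum f ?P4"
  proof -
    note D = hole_splitsD[OF _ mN]
    \<comment> \<open>The images are told apart by whether the left part ends in \<open>N\<close>
      and whether the right part starts with \<open>N\<close>: around a marked hole neither happens,
      because holes are never adjacent.\<close>
    have d1: "?f1 ` ?P1 \<inter> ?f2 ` ?P2 = {}"
      using D(4) by fastforce
    have d2: "(?f1 ` ?P1 \<union> ?f2 ` ?P2) \<inter> ?f3 ` ?P3 = {}"
      using D(5) by (fastforce simp: nonfinal_hole_splits_def)
    have d3: "(?f1 ` ?P1 \<union> ?f2 ` ?P2 \<union> ?f3 ` ?P3) \<inter> ?P4 = {}"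
    proof -
      have "(?f1 ` ?P1 \<union> ?f2 ` ?P2) \<inter> ?P4 = {}"
        using D(5) by (fastforce simp: nonfinal_hole_splits_def)
      moreover have "?f3 ` ?P3 \<inter> ?P4 = {}"
        using D(4) by (fastforce simp: nonfinal_hole_splits_def)
      ultimately show ?thesis
        by (simp only: Int_Un_distrib2) simp
    qed
    show ?thesis
      unfolding max_splits_eq[OF N]
      by (simp only: sum.union_disjoint d1 d2 d3 finite_hole_splits finite_imageI finite_UnI)
  qed
  also have "sum f (?f1 ` ?P1) = sum (split_weight N) ?P1"
    using occ_31_2_list_fill_hole(1)[OF _ N]
    by (subst sum.reindex) (auto simp: f_def split_weight_def intro!: inj_onI sum.cong)
  also have "sum f (?f2 ` ?P2) = sum (split_weight N) ?P2"
    using occ_31_2_list_fill_hole(2)[OF _ N]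
    by (subst sum.reindex) (auto simp: f_def split_weight_def intro!: inj_onI sum.cong)
  also have "sum f (?f3 ` ?P3) = sum (split_weight N) ?P3"
    using occ_31_2_list_fill_hole(3)[OF _ N]
    by (subst sum.reindex)
      (auto simp: f_def split_weight_def nonfinal_hole_splits_def intro!: inj_onI sum.cong)
  also have "sum f ?P4 = sum (split_weight N) ?P4"
    using occ_31_2_list_fill_hole(4)[OF _ N]
    by (auto simp: f_def split_weight_def nonfinal_hole_splits_def intro!: sum.cong)
  finally show ?thesis
    by (simp add: sum_hole_splits[OF mN] sum_nonfinal_hole_splits[OF mN] algebra_simps)
qed

section \<open>Comparison with Dyck prefixes and the value at q = -1\<close>

lemma hole_poly_0: "hole_poly N 0 (Suc c) = (if c = 0 then 1 else 0)"
proof -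
  have rep: "w = replicate (Suc c) N" if "w \<in> hole_words N 0 (Suc c)" for w
  proof -
    have w: "mset w = replicate_mset (Suc c) N"
      using that by (simp add: hole_words_def)
    then have "size (mset w) = Suc c" "set_mset (mset w) = {N}"
      by (simp_all only: size_replicate_mset set_mset_replicate_mset_subset) simp
    then show ?thesis
      by (intro replicate_eqI) auto
  qed
  show ?thesis
  proof (cases c)
    case 0
    then have "hole_words N 0 (Suc c) = {[N]}"
      using rep by (auto simp: hole_words_def)
    then show ?thesis
      using 0 by (simp add: hole_poly_def)
  next
    case (Suc d)
    have "w \<notin> hole_words N 0 (Suc c)" for w
    proof
      assume w: "w \<in> hole_words N 0 (Suc c)"
      then have "w = N # N # replicate d N"
        using rep Suc by simp
      then show False
        using w by (simp add: hole_words_def)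
    qed
    then have "hole_words N 0 (Suc c) = {}"
      by blast
    then show ?thesis
      using Suc by (simp add: hole_poly_def)
  qed
qed

text \<open>One inserted value matches two path steps, and \<open>h\<close> counts the holes other
  than the last. Up-down and down-up at height \<open>2 * h\<close> weigh
  \<open>q_int (Suc h)\<close> and \<open>q_int h\<close>; two downs from \<open>2 * h + 2\<close>
  weigh the square of \<open>q_int (Suc h)\<close>. The hole recurrence instead gives
  \<open>q_int h\<close> to a gain and \<open>q_int (Suc h)\<close> to a loss of a hole; the
  q-factorial moves the former weight onto the latter.\<close>

lemma hole_poly_eq_dyck_prefix:
  "m < N \<Longrightarrow> hole_poly N m (Suc h) = (\<Prod>i=1..h. q_int i) * dyck_prefix sfrac_coeff (2 * m) (2 * h)"
proof (induction m arbitrary: h)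
  case 0
  then show ?case
    by (simp add: hole_poly_0)
next
  case (Suc m)
  then have IH: "hole_poly N m (Suc h) =
      (\<Prod>i=1..h. q_int i) * dyck_prefix sfrac_coeff (2 * m) (2 * h)" for h
    by simp
  show ?case
  proof (cases h)
    case 0
    \<comment> \<open>This removes the two terms of the hole recurrence that have no counterpart at
      height 0: coming from a lower height, and down-up.\<close>
    have "q_int 0 = 0"
      by (simp add: q_int_def)
    moreover have "dyck_prefix sfrac_coeff (2 * Suc m) 0 =
        q_int 1 * dyck_prefix sfrac_coeff (2 * m) 0 +
        q_int 1 * (q_int 1 * dyck_prefix sfrac_coeff (2 * m) 2)"
      using sfrac_coeff_odd[of 1] sfrac_coeff_even[of 1]
      by (simp add: numeral_2_eq_2 algebra_simps)
    ultimately show ?thesis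
      using 0 IH[of 0] IH[of 1] hole_poly_Suc[OF Suc.prems, of 0]
      by (simp add: numeral_2_eq_2 algebra_simps)
  next
    case (Suc g)
    let ?D = "\<lambda>g. dyck_prefix sfrac_coeff (2 * m) (2 * g)"
    have coeff: "sfrac_coeff (Suc (Suc (2 * g))) = q_int (Suc g)"
      "sfrac_coeff (Suc (Suc (Suc (2 * g)))) = q_int (Suc (Suc g))"
      "sfrac_coeff (Suc (Suc (Suc (Suc (2 * g))))) = q_int (Suc (Suc g))"
      by (simp_all add: sfrac_coeff_def)
    have D: "dyck_prefix sfrac_coeff (2 * Suc m) (2 * Suc g) = ?D g +
        (q_int (Suc g) + q_int (Suc (Suc g))) * ?D (Suc g) +
        q_int (Suc (Suc g)) * q_int (Suc (Suc g)) * ?D (Suc (Suc g))"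
      by (simp add: coeff, simp add: algebra_simps)
    have "hole_poly N (Suc m) (Suc (Suc g)) = q_int (Suc g) * hole_poly N m (Suc g) +
        (q_int (Suc (Suc g)) + q_int (Suc g)) * hole_poly N m (Suc (Suc g)) +
        q_int (Suc (Suc g)) * hole_poly N m (Suc (Suc (Suc g)))"
      by (rule hole_poly_Suc[OF Suc.prems])
    also have "\<dots> = (\<Prod>i=1..Suc g. q_int i) * dyck_prefix sfrac_coeff (2 * Suc m) (2 * Suc g)"
      unfolding D IH by (simp add: algebra_simps)
    finally show ?thesis
      using Suc by simp
  qed
qed

lemma poly_q_int_minus_one: "poly (q_int k) (- 1) = (if odd k then 1 else 0)"
  by (induction k) (auto simp: q_int_def poly_monom)

text \<open>At \<open>q = -1\<close> the factor \<open>[2]\<^sub>q\<close> vanishes, so only words with at most two holes contribute.\<close>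

lemma poly_hole_poly_minus_one:
  "Suc m < N \<Longrightarrow> poly (hole_poly N (Suc m) (Suc 0)) (- 1) = 2 ^ m \<and>
     poly (hole_poly N (Suc m) (Suc (Suc 0))) (- 1) = 2 ^ m"
  by (induction m) (simp_all add: hole_poly_Suc hole_poly_0 poly_q_int_minus_one)

section \<open>Permutations\<close>

lemma finite_perms: "finite (perms n)"
  by (simp add: perms_def finite_permutations)

lemma bij_betw_perms_permutations_of_set:
  "bij_betw (\<lambda>\<sigma>. map \<sigma> [1..<Suc n]) (perms n) (permutations_of_set {1..n})"
proof -
  let ?f = "\<lambda>\<sigma>. map \<sigma> [1..<Suc n]"
  have inj: "inj_on ?f (perms n)"
  proof (rule inj_onI)
    fix \<sigma> \<sigma>'
    assume s: "\<sigma> \<in> perms n" "\<sigma>' \<in> perms n" "?f \<sigma> = ?f \<sigma>'"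
    show "\<sigma> = \<sigma>'"
    proof
      fix i
      show "\<sigma> i = \<sigma>' i"
      proof (cases "i \<in> {1..n}")
        case True
        then show ?thesis
          using s(3) by (auto simp: map_eq_conv simp del: upt_Suc)
      next
        case False
        then show ?thesis
          using s(1,2) by (simp add: perms_def permutes_not_in)
      qed
    qed
  qed
  have sub: "?f ` perms n \<subseteq> permutations_of_set {1..n}"
  proof safe
    fix \<sigma>
    assume "\<sigma> \<in> perms n"
    then have s: "\<sigma> permutes {1..n}"
      by (simp add: perms_def)
    show "?f \<sigma> \<in> permutations_of_set {1..n}"
    proof (rule permutations_of_setI)
      show "set (?f \<sigma>) = {1..n}"
        using permutes_image[OF s] by (simp add: atLeastLessThanSuc_atLeastAtMost del: upt_Suc)
      show "distinct (?f \<sigma>)"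
        using permutes_inj_on[OF s] by (simp add: distinct_map del: upt_Suc)
    qed
  qed
  \<comment> \<open>Surjectivity follows from injectivity, since both sides have n!
    elements.\<close>
  have "card (?f ` perms n) = card (permutations_of_set {1..n})"
    unfolding card_image[OF inj] by (simp add: perms_def card_permutations[of _ n])
  then have "?f ` perms n = permutations_of_set {1..n}"
    by (intro card_subset_eq sub) simp_all
  then show ?thesis
    using inj by (simp add: bij_betw_def)
qed

text \<open>Once all values are inserted, the only remaining hole is the sentinel at the
  end.\<close>

lemma bij_betw_permutations_of_set_hole_words:
  assumes "n < N"
  shows "bij_betw (\<lambda>xs. xs @ [N]) (permutations_of_set {1..n}) (hole_words N n (Suc 0))"
proof (rule bij_betw_imageI)
  show "(\<lambda>xs. xs @ [N]) ` permutations_of_set {1..n} = hole_words N n (Suc 0)"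
  proof (intro equalityI subsetI)
    fix w
    assume "w \<in> (\<lambda>xs. xs @ [N]) ` permutations_of_set {1..n}"
    then obtain xs where w: "w = xs @ [N]" and xs: "xs \<in> permutations_of_set {1..n}"
      by blast
    have "N \<notin> set xs"
      using permutations_of_setD(1)[OF xs] assms by simp
    moreover have "successively (\<lambda>a b. a \<noteq> N \<or> b \<noteq> N) xs" if "N \<notin> set xs" for xs
      using that by (induction xs) (auto simp: successively_Cons)
    moreover have "mset xs = mset_set {1..n}"
      using xs by (simp add: permutations_of_set_altdef permutations_of_multiset_def)
    ultimately show "w \<in> hole_words N n (Suc 0)"
      unfolding hole_words_def w
      using last_in_set[of xs] by (auto simp: successively_append_iff)
  next
    fix w
    assume w: "w \<in> hole_words N n (Suc 0)"
    then obtain xs where xs: "w = xs @ [N]"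
      by (cases w rule: rev_cases) (auto simp: hole_words_def)
    have "mset xs = mset_set {1..n}"
      using w xs by (simp add: hole_words_def)
    then have "xs \<in> permutations_of_set {1..n}"
      by (simp add: permutations_of_set_altdef permutations_of_multiset_def)
    then show "w \<in> (\<lambda>xs. xs @ [N]) ` permutations_of_set {1..n}"
      using xs by blast
  qed
qed (auto intro: inj_onI)

lemma occ_31_2_eq_occ_31_2_list: "occ_31_2 n \<sigma> = occ_31_2_list (map \<sigma> [1..<Suc n])"
proof -
  let ?xs = "map \<sigma> [1..<Suc n]"
  let ?S = "{(i, k). i + 1 < k \<and> k < length ?xs \<and> ?xs ! (i + 1) < ?xs ! k \<and> ?xs ! k < ?xs ! i}"
  have nth: "?xs ! i = \<sigma> (Suc i)" if "i < n" for i
    using that by (simp del: upt_Suc)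
  have "{(i, k). 1 \<le> i \<and> i + 1 < k \<and> k \<le> n \<and> \<sigma> (i + 1) < \<sigma> k \<and> \<sigma> k < \<sigma> i} =
      map_prod Suc Suc ` ?S" (is "?L = _")
  proof (intro equalityI subsetI)
    fix p
    assume "p \<in> ?L"
    then obtain i k where p: "p = (i, k)" and
      ik: "1 \<le> i" "i + 1 < k" "k \<le> n" "\<sigma> (i + 1) < \<sigma> k" "\<sigma> k < \<sigma> i"
      by auto
    then have "(i - 1, k - 1) \<in> ?S"
      using nth[of i] nth[of "i - 1"] nth[of "k - 1"] by (auto simp del: upt_Suc)
    moreover have "p = map_prod Suc Suc (i - 1, k - 1)"
      using p ik by simp
    ultimately show "p \<in> map_prod Suc Suc ` ?S"
      by blast
  next
    fix p
    assume "p \<in> map_prod Suc Suc ` ?S"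
    then obtain i k where "p = (Suc i, Suc k)" "i + 1 < k" "k < n"
      "?xs ! (i + 1) < ?xs ! k" "?xs ! k < ?xs ! i"
      by (auto simp del: upt_Suc)
    then show "p \<in> ?L"
      using nth[of i] nth[of "i + 1"] nth[of k] by (simp del: upt_Suc)
  qed
  moreover have "card (map_prod Suc Suc ` ?S) = card ?S"
    by (rule card_image) (auto intro: inj_onI)
  ultimately show ?thesis
    by (simp only: occ_31_2_def occ_31_2_list_eq_card)
qed

lemma stat_poly_occ_31_2:
  assumes "n < N"
  shows "stat_poly occ_31_2 n = hole_poly N n (Suc 0)"
proof -
  have "stat_poly occ_31_2 n =
      (\<Sum>\<sigma>\<in>perms n. monom 1 (occ_31_2_list (map \<sigma> [1..<Suc n])))"
    by (simp only: stat_poly_def occ_31_2_eq_occ_31_2_list)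
  also have "\<dots> = (\<Sum>xs\<in>permutations_of_set {1..n}. monom 1 (occ_31_2_list xs))"
    by (rule sum.reindex_bij_betw[OF bij_betw_perms_permutations_of_set])
  also have "\<dots> = (\<Sum>xs\<in>permutations_of_set {1..n}. monom 1 (occ_31_2_list (xs @ [N])))"
  proof (rule sum.cong[OF refl])
    fix xs
    assume "xs \<in> permutations_of_set {1..n}"
    then have "x < N" if "x \<in> set xs" for x
      using that assms by (auto dest: permutations_of_setD(1))
    then show "monom (1 :: int) (occ_31_2_list xs) = monom 1 (occ_31_2_list (xs @ [N]))"
      by (simp add: occ_31_2_list_snoc_max)
  qed
  also have "\<dots> = hole_poly N n (Suc 0)"
    unfolding hole_poly_def
    by (rule sum.reindex_bij_betw[OF bij_betw_permutations_of_set_hole_words[OF assms]])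
  finally show ?thesis .
qed

section \<open>Reversal and complement\<close>

text \<open>Composing with this map on the right reverses a permutation, on the left complements it.
  It is the identity outside the interval so that it permutes \<open>{1..n}\<close>.\<close>

definition reflect :: "nat \<Rightarrow> nat \<Rightarrow> nat" where
  "reflect n i = (if i \<in> {1..n} then Suc n - i else i)"

lemma reflect_reflect: "reflect n (reflect n i) = i"
  by (auto simp: reflect_def)

lemma reflect_permutes: "reflect n permutes {1..n}"
proof (rule bij_imp_permutes)
  show "bij_betw (reflect n) {1..n} {1..n}"
    by (rule bij_betw_byWitness[where f' = "reflect n"])
      (auto simp: reflect_reflect, auto simp: reflect_def)
qed (auto simp: reflect_def)

lemma stat_poly_eqI:
  assumes "\<And>\<sigma>. \<sigma> \<in> perms n \<Longrightarrow> f \<sigma> \<in> perms n \<and> f (f \<sigma>) = \<sigma> \<and> s' n (f \<sigma>) = s n \<sigma>"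
  shows "stat_poly s' n = stat_poly s n"
  unfolding stat_poly_def
proof (rule sum.reindex_bij_witness[of _ f f])
  fix \<sigma>
  assume \<sigma>: "\<sigma> \<in> perms n"
  show "monom (1 :: int) (s n (f \<sigma>)) = monom 1 (s' n \<sigma>)"
    using assms[of "f \<sigma>"] assms[OF \<sigma>] by simp
qed (use assms in simp_all)

lemma occ_2_13_reverse: "occ_2_13 n (\<sigma> \<circ> reflect n) = occ_31_2 n \<sigma>"
proof -
  define A where "A = {(i, j). 1 \<le> i \<and> i < j \<and> j + 1 \<le> n \<and> (\<sigma> \<circ> reflect n) j < (\<sigma> \<circ> reflect n) i \<and>
    (\<sigma> \<circ> reflect n) i < (\<sigma> \<circ> reflect n) (j + 1)}"
  define B where "B = {(i, k). 1 \<le> i \<and> i + 1 < k \<and> k \<le> n \<and> \<sigma> (i + 1) < \<sigma> k \<and> \<sigma> k < \<sigma> i}"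
  \<comment> \<open>Reversal sends the adjacent positions \<open>j\<close>, \<open>j + 1\<close> to
    \<open>n + 1 - j\<close>, \<open>n - j\<close>; the new pair is indexed by its left end
    \<open>n - j\<close>.\<close>
  let ?f = "\<lambda>(i, j). (n - j, Suc n - i)" and ?g = "\<lambda>(i, k). (Suc n - k, n - i)"
  have "?f p \<in> B \<and> ?g (?f p) = p" if "p \<in> A" for p
    using that by (auto simp: A_def B_def reflect_def Suc_diff_le)
  moreover have "?g p \<in> A \<and> ?f (?g p) = p" if "p \<in> B" for p
    using that by (auto simp: A_def B_def reflect_def Suc_diff_le)
  ultimately have "bij_betw ?f A B"
    by (intro bij_betw_byWitness[where f' = ?g]) blast+
  then show ?thesis
    unfolding occ_2_13_def occ_31_2_def A_def B_def by (rule bij_betw_same_card)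
qed

lemma reflect_less_iff: "i \<in> {1..n} \<Longrightarrow> j \<in> {1..n} \<Longrightarrow> reflect n i < reflect n j \<longleftrightarrow> j < i"
  by (auto simp: reflect_def)

lemma occ_complement:
  assumes "\<sigma> \<in> perms n"
  shows "occ_13_2 n (reflect n \<circ> \<sigma>) = occ_31_2 n \<sigma>"
    and "occ_2_31 n (reflect n \<circ> \<sigma>) = occ_2_13 n \<sigma>"
proof -
  have less: "(reflect n \<circ> \<sigma>) i < (reflect n \<circ> \<sigma>) j \<longleftrightarrow> \<sigma> j < \<sigma> i"
    if "1 \<le> i" "i \<le> n" "1 \<le> j" "j \<le> n" for i j
    using that assms permutes_in_image[of \<sigma> "{1..n}"] by (simp add: perms_def reflect_less_iff)
  show "occ_13_2 n (reflect n \<circ> \<sigma>) = occ_31_2 n \<sigma>"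
    unfolding occ_13_2_def occ_31_2_def
    by (rule arg_cong[of _ _ card]) (auto simp: less simp del: o_apply)
  show "occ_2_31 n (reflect n \<circ> \<sigma>) = occ_2_13 n \<sigma>"
    unfolding occ_2_31_def occ_2_13_def
    by (rule arg_cong[of _ _ card]) (auto simp: less simp del: o_apply)
qed

lemma stat_poly_patterns:
  "stat_poly occ_2_13 n = stat_poly occ_31_2 n"
  "stat_poly occ_13_2 n = stat_poly occ_31_2 n"
  "stat_poly occ_2_31 n = stat_poly occ_31_2 n"
proof -
  have inv: "reflect n \<circ> reflect n = id"
    by (simp add: fun_eq_iff reflect_reflect)
  have right: "\<sigma> \<circ> reflect n \<in> perms n \<and> \<sigma> \<circ> reflect n \<circ> reflect n = \<sigma>" if "\<sigma> \<in> perms n" for \<sigma>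
    using that inv reflect_permutes by (auto simp: perms_def permutes_compose o_assoc[symmetric])
  have left: "reflect n \<circ> \<sigma> \<in> perms n \<and> reflect n \<circ> (reflect n \<circ> \<sigma>) = \<sigma>" if "\<sigma> \<in> perms n" for \<sigma>
    using that inv reflect_permutes by (auto simp: perms_def permutes_compose o_assoc)
  show 1: "stat_poly occ_2_13 n = stat_poly occ_31_2 n"
    by (rule stat_poly_eqI[of _ "\<lambda>\<sigma>. \<sigma> \<circ> reflect n"]) (simp add: right occ_2_13_reverse)
  show "stat_poly occ_13_2 n = stat_poly occ_31_2 n"
    by (rule stat_poly_eqI[of _ "\<lambda>\<sigma>. reflect n \<circ> \<sigma>"]) (simp add: left occ_complement)
  \<comment> \<open>Complement leads from 2-31 only to 2-13; reversal then leads to 31-2.\<close>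
  have "stat_poly occ_2_31 n = stat_poly occ_2_13 n"
    by (rule stat_poly_eqI[of _ "\<lambda>\<sigma>. reflect n \<circ> \<sigma>"]) (simp add: left occ_complement)
  with 1 show "stat_poly occ_2_31 n = stat_poly occ_31_2 n"
    by simp
qed

theorem theorem3p7:
  fixes \<tau> :: "nat \<Rightarrow> (nat \<Rightarrow> nat) \<Rightarrow> nat"
  assumes "\<tau> \<in> {occ_2_13, occ_2_31, occ_13_2, occ_31_2}"
  shows "has_sfrac_expansion (Abs_fps (\<lambda>n. stat_poly \<tau> n)) sfrac_coeff
    \<and> stat_exhibits_CSP \<tau> (\<lambda>n. if n = 0 then 1 else 2 ^ (n - 1))"
proof
  have \<tau>: "stat_poly \<tau> n = hole_poly (Suc n) n (Suc 0)" for n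
    using assms stat_poly_patterns[of n] stat_poly_occ_31_2[of n "Suc n"] by auto
  have "stat_poly \<tau> n = dyck_prefix sfrac_coeff (2 * n) 0" for n
    \<comment> \<open>With only the last hole left, \<open>h = 0\<close> and the q-factorial is the
      empty product.\<close>
    using hole_poly_eq_dyck_prefix[of n "Suc n" 0] by (simp add: \<tau>)
  then show "has_sfrac_expansion (Abs_fps (\<lambda>n. stat_poly \<tau> n)) sfrac_coeff"
    by (simp add: has_sfrac_expansion_dyck_prefix)
  \<comment> \<open>An involution enters the sieving condition only through its number of fixed
    points, so the two evaluations suffice.\<close>
  have "poly (stat_poly \<tau> n) 1 = int (card (perms n))" for n
    by (simp add: stat_poly_def poly_sum poly_monom)
  moreover have "poly (stat_poly \<tau> n) (- 1) = int (if n = 0 then 1 else 2 ^ (n - 1))" for n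
    using poly_hole_poly_minus_one[of "n - 1" "Suc n"]
    by (cases n) (simp_all add: \<tau> hole_poly_0)
  ultimately show "stat_exhibits_CSP \<tau> (\<lambda>n. if n = 0 then 1 else 2 ^ (n - 1))"
    by (simp add: stat_exhibits_CSP_def exhibits_CSP_def finite_perms)
qed

end
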